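(* Let integers $k,n$ be given, with $n\ge0$, and set $N=2n$. Then there exist unique values $b_{j,n}(k)\in\mathbb{Q}$ ($j=0,1,\ldots,n$) with the following property: there exist $c_0,c_1,\ldots\in\mathbb{Q}$ such that the generalized Wolstenholme coefficients $b_0,b_1,\ldots,b_N$ associated with the data $[k,(c_0,c_1,\ldots),N]$ satisfy $b_j=b_{j,n}(k)$ for $0\le j\le n$ and $$b_{n+1}=b_{n+2}=\cdots=b_{2n}=0.$$ Additionally, the $c_j$ may be taken to be integers, so that the $b_{j,n}(k)$ are necessarily integers. Moreover, with $b_j=b_{j,n}(k)$ for $0\le j\le n$: the congruence $$\binom{kp-1}{p-1}\equiv b_0+b_1\,p\,H(\{1\}^1;p-1)+\cdots+b_n\,p^nH(\{1\}^n;p-1)\pmod{p^{2n+3}}$$ holds for all odd primes $p\ne 2n+3$; in the case that $p=2n+3$ is prime, $$\binom{kp-1}{p-1}\equiv b_0+b_1\,p\,H(\{1\}^1;p-1)+\cdots+b_n\,p^nH(\{1\}^n;p-1)\pmod{p^{2n+2}};$$ and for odd primes $p\le 2n+1$, $$\binom{kp-1}{p-1}= b_0+b_1\,p\,H(\{1\}^1;p-1)+\cdots+b_n\,p^nH(\{1\}^n;p-1).$$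
   Context: For non-negative integers $j,m$, the elementary symmetric multiple harmonic sum is $H(\{1\}^j;m)=\sum_{m\ge i_1>i_2>\cdots>i_j\ge 1}\frac{1}{i_1 i_2\cdots i_j}\in\mathbb{Q}$, with $H(\{1\}^0;m)=1$ and $H(\{1\}^j;m)=0$ if $j>m$. Given integers $k$ and $N\ge 0$ and a sequence $c_0,c_1,\ldots\in\mathbb{Q}$, the generalized Wolstenholme coefficients associated with the data $[k,(c_0,c_1,\ldots),N]$ are the numbers $b_0,\ldots,b_N$ given by $$b_j=(k-1)^j+c_j+(-1)^{j+1}\sum_{i=0}^{j}\binom{j}{i}c_i ,$$ with $(k-1)^0=1$. For an arbitrary integer $x$, $\binom{x}{m}=x(x-1)\cdots(x-m+1)/m!$. Congruences modulo $p^m$ are between rational numbers with denominators prime to $p$: $x\equiv y\pmod{p^m}$ means $x-y$ has $p$-adic valuation at least $m$. *)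

theory Defs
  imports Complex_Main "HOL-Computational_Algebra.Primes"
begin

text \<open>The index tuples \<open>m \<ge> i\<^sub>1 > \<dots> > i\<^sub>j \<ge> 1\<close> are the strictly decreasing lists of
  length \<open>j\<close> over \<open>{1..m}\<close>. The conventions \<open>H 0 m = 1\<close> (only the empty list) and
  \<open>H j m = 0\<close> for \<open>j > m\<close> (no such list) are consequences.\<close>

definition H :: "nat \<Rightarrow> nat \<Rightarrow> rat" where
  "H j m = (\<Sum>is | length is = j \<and> sorted_wrt (>) is \<and> set is \<subseteq> {1..m}.
              1 / (\<Prod>i\<leftarrow>is. of_nat i))"

text \<open>The coefficient \<open>b\<^sub>j\<close> associated with the data \<open>[k, (c\<^sub>0, c\<^sub>1, \<dots>), N]\<close>. The formula does
  not depend on \<open>N\<close>, which only restricts the index to \<open>j \<le> N\<close>.\<close>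

definition gen_wolstenholme_coeff :: "int \<Rightarrow> (nat \<Rightarrow> rat) \<Rightarrow> nat \<Rightarrow> rat" where
  "gen_wolstenholme_coeff k c j =
     (of_int k - 1) ^ j + c j + (- 1) ^ (j + 1) * (\<Sum>i=0..j. of_nat (j choose i) * c i)"

text \<open>\<open>b\<close> is only looked at on \<open>{0..n}\<close>.\<close>

definition realizes :: "int \<Rightarrow> nat \<Rightarrow> (nat \<Rightarrow> rat) \<Rightarrow> (nat \<Rightarrow> rat) \<Rightarrow> bool" where
  "realizes k n c b \<longleftrightarrow>
     (\<forall>j\<in>{0..n}. gen_wolstenholme_coeff k c j = b j) \<and>
     (\<forall>j\<in>{n+1..2*n}. gen_wolstenholme_coeff k c j = 0)"

text \<open>The \<open>p\<close>-adic valuation of a nonzero rational number; the value at \<open>0\<close> is meaningless,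
  so \<open>rat_cong\<close> treats that case (valuation infinity) separately.\<close>

definition padic_val :: "nat \<Rightarrow> rat \<Rightarrow> int" where
  "padic_val p x = int (multiplicity (int p) (fst (quotient_of x)))
                 - int (multiplicity (int p) (snd (quotient_of x)))"

definition p_integral :: "nat \<Rightarrow> rat \<Rightarrow> bool" where
  "p_integral p x \<longleftrightarrow> coprime (int p) (snd (quotient_of x))"

definition rat_cong :: "nat \<Rightarrow> nat \<Rightarrow> rat \<Rightarrow> rat \<Rightarrow> bool" where
  "rat_cong p m x y \<longleftrightarrow>
     p_integral p x \<and> p_integral p y \<and> (x = y \<or> int m \<le> padic_val p (x - y))"

end

theory Submission
  imports Defs "HOL-Computational_Algebra.Polynomial"
begin

text \<open>Put \<open>h\<^sub>j = p\<^sup>j H j (p - 1)\<close> and \<open>f(x) = \<Sum>j. h\<^sub>j x\<^sup>j = \<Prod>i. (1 + x p / i)\<close>. For odd \<open>p\<close> pairing \<open>i\<close> with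
  \<open>p - i\<close> gives \<open>f(-1 - x) = f(x)\<close>, while \<open>f(k - 1)\<close> is the binomial coefficient. Applying the
  functional \<open>x\<^sup>j \<mapsto> c\<^sub>j\<close> to both sides of the symmetry shows that the binomial coefficient equals
  \<open>\<Sum>j. b\<^sub>j h\<^sub>j\<close> for every choice of \<open>c\<close>. The functionals \<open>x\<^sup>j \<mapsto> b\<^sub>j\<close> arising in this way are exactly
  those which send \<open>(x (x + 1))\<^sup>i\<close> to \<open>(k (k - 1))\<^sup>i\<close>; as \<open>(x (x + 1))\<^sup>i\<close> has lowest term \<open>x\<^sup>i\<close> and
  degree \<open>2 i\<close>, requiring \<open>b\<^sub>j = 0\<close> for \<open>n < j \<le> 2 n\<close> leaves a unitriangular system over the integers for
  \<open>b\<^sub>0, \<dots>, b\<^sub>n\<close>. The terms with \<open>j > 2 n\<close> are small: \<open>p\<close> divides \<open>H j (p - 1)\<close> for \<open>1 \<le> j \<le> p - 2\<close>,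
  and the symmetry makes the first of them, of odd index, divisible by the same power of \<open>p\<close> as the later ones.\<close>

subsection \<open>Sequences as functionals on polynomials\<close>

text \<open>A sequence \<open>c\<close> stands for the linear functional \<open>x\<^sup>j \<mapsto> c j\<close>: \<open>quad_shift\<close> is the transpose of
  multiplication by \<open>x (x + 1)\<close>, and \<open>reflect\<close> is the transpose of \<open>x \<mapsto> -1 - x\<close>.\<close>

definition quad_shift :: "(nat \<Rightarrow> 'a::comm_ring_1) \<Rightarrow> nat \<Rightarrow> 'a" where
  "quad_shift c j = c (Suc j) + c (Suc (Suc j))"

definition reflect :: "(nat \<Rightarrow> 'a::comm_ring_1) \<Rightarrow> nat \<Rightarrow> 'a" where
  "reflect c j = (-1) ^ j * (\<Sum>i\<le>j. of_nat (j choose i) * c i)"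

text \<open>Transposes
  \<open>(-1 - x) ^ Suc j = - ((-1 - x) ^ j + x * (-1 - x) ^ j)\<close>.\<close>

lemma reflect_Suc:
  "reflect c (Suc j) = - (reflect c j + reflect (\<lambda>i. c (Suc i)) j)"
proof -
  have "(\<Sum>i\<le>Suc j. of_nat (Suc j choose i) * c i)
      = c 0 + (\<Sum>i\<le>j. of_nat (Suc j choose Suc i) * c (Suc i))"
    by (subst sum.atMost_Suc_shift) simp
  also have "\<dots> = (c 0 + (\<Sum>i\<le>j. of_nat (j choose Suc i) * c (Suc i)))
       + (\<Sum>i\<le>j. of_nat (j choose i) * c (Suc i))"
    by (simp add: algebra_simps sum.distrib)
  also have "c 0 + (\<Sum>i\<le>j. of_nat (j choose Suc i) * c (Suc i))
      = (\<Sum>i\<le>Suc j. of_nat (j choose i) * c i)"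
    by (subst sum.atMost_Suc_shift) simp
  also have "\<dots> = (\<Sum>i\<le>j. of_nat (j choose i) * c i)" by (simp add: binomial_eq_0)
  finally show ?thesis by (simp add: reflect_def algebra_simps)
qed

lemma reflect_add: "reflect (\<lambda>i. c i + d i) j = reflect c j + reflect d j"
  by (simp add: reflect_def algebra_simps sum.distrib)

text \<open>The polynomial \<open>x (x + 1)\<close> is invariant under
  \<open>x \<mapsto> -1 - x\<close>, so the two transposes commute.\<close>

lemma quad_shift_reflect: "quad_shift (reflect c) = reflect (quad_shift c)"
proof
  fix j
  have "quad_shift (reflect c) j = reflect (\<lambda>i. c (Suc i)) j + reflect (\<lambda>i. c (Suc (Suc i))) j"
    using reflect_Suc[of c "Suc j"] reflect_Suc[of "\<lambda>i. c (Suc i)" j]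
    by (simp add: quad_shift_def)
  then show "quad_shift (reflect c) j = reflect (quad_shift c) j"
    by (simp add: quad_shift_def[abs_def] reflect_add)
qed

lemma quad_shift_funpow_reflect: "(quad_shift ^^ i) (reflect c) = reflect ((quad_shift ^^ i) c)"
  by (induction i) (simp_all add: quad_shift_reflect)

lemma quad_shift_funpow_add:
  "(quad_shift ^^ i) (\<lambda>j. c j + d j) = (\<lambda>j. (quad_shift ^^ i) c j + (quad_shift ^^ i) d j)"
  by (induction i) (simp_all add: quad_shift_def fun_eq_iff)

lemma quad_shift_funpow_diff:
  "(quad_shift ^^ i) (\<lambda>j. c j - d j) = (\<lambda>j. (quad_shift ^^ i) c j - (quad_shift ^^ i) d j)"
  by (induction i) (simp_all add: quad_shift_def fun_eq_iff)

lemma quad_shift_funpow_power: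
  "(quad_shift ^^ i) (\<lambda>j. a ^ j) = (\<lambda>j. (a * (a + 1)) ^ i * a ^ j)"
  by (induction i) (simp_all add: quad_shift_def fun_eq_iff algebra_simps)

lemma quad_shift_funpow_Suc:
  "(quad_shift ^^ Suc i) c j = (quad_shift ^^ i) c (Suc j) + (quad_shift ^^ i) c (Suc (Suc j))"
  by (simp add: quad_shift_def)

lemma quad_shift_funpow_binomial:
  "(quad_shift ^^ i) c j = (\<Sum>l\<le>i. of_nat (i choose l) * c (i + l + j))"
proof (induction i arbitrary: j)
  case (Suc i)
  have "(\<Sum>l\<le>Suc i. of_nat (Suc i choose l) * c (Suc i + l + j))
      = c (Suc i + j) + (\<Sum>l\<le>i. of_nat (Suc i choose Suc l) * c (Suc (Suc (i + l + j))))"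
    by (subst sum.atMost_Suc_shift) simp
  also have "\<dots> = (c (Suc i + j) + (\<Sum>l\<le>i. of_nat (i choose Suc l) * c (Suc (Suc (i + l + j)))))
      + (\<Sum>l\<le>i. of_nat (i choose l) * c (Suc (Suc (i + l + j))))"
    by (simp add: algebra_simps sum.distrib)
  also have "c (Suc i + j) + (\<Sum>l\<le>i. of_nat (i choose Suc l) * c (Suc (Suc (i + l + j))))
      = (\<Sum>l\<le>Suc i. of_nat (i choose l) * c (Suc (i + l + j)))"
    by (subst sum.atMost_Suc_shift) simp
  also have "(\<Sum>l\<le>Suc i. of_nat (i choose l) * c (Suc (i + l + j)))
      = (\<Sum>l\<le>i. of_nat (i choose l) * c (Suc (i + l + j)))"
    by (simp add: binomial_eq_0)
  finally show ?case by (simp only: quad_shift_funpow_Suc Suc.IH add_Suc_right)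
qed simp

section \<open>The triangular system for the coefficients\<close>

lemma quad_shift_funpow_leading:
  "(quad_shift ^^ i) c 0 = c i + (\<Sum>l\<in>{1..i}. of_nat (i choose l) * c (i + l))"
  by (simp add: quad_shift_funpow_binomial atMost_atLeast0 sum.atLeast_Suc_atMost)

text \<open>Back substitution: equation \<open>i = j\<close> involves \<open>e j\<close> with
  coefficient 1 and otherwise only entries of larger index, so the entries vanish from the top
  down.\<close>

lemma zero_if_quad_shift_zero:
  assumes "\<And>i. i \<le> n \<Longrightarrow> (quad_shift ^^ i) e 0 = 0"
    and "\<And>j. n < j \<Longrightarrow> j \<le> 2 * n \<Longrightarrow> e j = 0"
    and "j \<le> 2 * n"
  shows "e j = 0"
  using assms(3)
proof (induction "2 * n - j" arbitrary: j rule: less_induct)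
  case less
  show ?case
  proof (cases "j \<le> n")
    case True
    \<comment> \<open>\<open>j \<le> n\<close> keeps \<open>j + l \<le> 2 * j\<close> within
      \<open>2 * n\<close>, the range of the induction.\<close>
    have "e (j + l) = 0" if "l \<in> {1..j}" for l
      using that True less.prems by (intro less.hyps) auto
    then show ?thesis
      using quad_shift_funpow_leading[of j e] assms(1)[OF True] by simp
  qed (use assms(2) less.prems in auto)
qed

text \<open>The system is solved from equation \<open>n\<close> down to equation \<open>m\<close>.
  All pivots are 1, so no division occurs and integers suffice. The full system is the case
  \<open>m = 0\<close>.\<close>

lemma exists_with_quad_shift:
  fixes t :: "nat \<Rightarrow> 'a::comm_ring_1"
  assumes "m \<le> Suc n"
  shows "\<exists>b. (\<forall>j>n. b j = 0) \<and> (\<forall>i. m \<le> i \<and> i \<le> n \<longrightarrow> (quad_shift ^^ i) b 0 = t i)"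
  using assms
proof (induction m rule: inc_induct)
  case base
  show ?case by (rule exI[of _ "\<lambda>_. 0"]) auto
next
  case (step m)
  then obtain b where b: "\<forall>j>n. b j = 0" "\<forall>i. Suc m \<le> i \<and> i \<le> n \<longrightarrow> (quad_shift ^^ i) b 0 = t i"
    by blast
  \<comment> \<open>Entry \<open>m\<close> is chosen to satisfy equation \<open>m\<close>; equations
    \<open>i > m\<close> only involve indices from \<open>i\<close> on and are undisturbed.\<close>
  define b' where "b' = b(m := t m - (\<Sum>l\<in>{1..m}. of_nat (m choose l) * b (m + l)))"
  have same: "(quad_shift ^^ i) b' 0 = (quad_shift ^^ i) b 0" if "m < i" for i
    using that unfolding quad_shift_funpow_binomial b'_def by (intro sum.cong) auto
  have "(quad_shift ^^ m) b' 0 = t m"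
    unfolding quad_shift_funpow_leading by (simp add: b'_def)
  then have "\<forall>i. m \<le> i \<and> i \<le> n \<longrightarrow> (quad_shift ^^ i) b' 0 = t i"
    using same b(2) by (metis Suc_leI le_neq_implies_less)
  moreover have "\<forall>j>n. b' j = 0"
    using b(1) step.hyps by (auto simp: b'_def)
  ultimately show ?case by blast
qed

text \<open>Since \<open>c (j + 2) = quad_shift c j - c (j + 1)\<close>, the first two entries of all iterates
  \<open>(quad_shift ^^ i) c\<close> determine the sequence, and they can be prescribed freely.\<close>

lemma eq_if_quad_shift_eq:
  assumes "\<And>i. 2 * i \<le> N \<Longrightarrow> (quad_shift ^^ i) c 0 = (quad_shift ^^ i) d 0"
    and "\<And>i. Suc (2 * i) \<le> N \<Longrightarrow> (quad_shift ^^ i) c 1 = (quad_shift ^^ i) d 1"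
    and "j \<le> N"
  shows "c j = d j"
proof -
  have "2 * i + j \<le> N \<Longrightarrow> (quad_shift ^^ i) c j = (quad_shift ^^ i) d j" for i
  proof (induction j arbitrary: i rule: less_induct)
    case (less j)
    consider "j = 0" | "j = 1" | l where "j = Suc (Suc l)"
      by (metis One_nat_def old.nat.exhaust)
    then show ?case
    proof cases
      case 3
      have "(quad_shift ^^ i) e j = (quad_shift ^^ Suc i) e l - (quad_shift ^^ i) e (Suc l)" for e :: "nat \<Rightarrow> 'a"
        by (simp only: quad_shift_funpow_Suc 3 add_diff_cancel_left')
      moreover have "(quad_shift ^^ Suc i) c l = (quad_shift ^^ Suc i) d l"
        by (rule less.IH) (use less.prems 3 in auto)
      moreover have "(quad_shift ^^ i) c (Suc l) = (quad_shift ^^ i) d (Suc l)"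
        by (rule less.IH) (use less.prems 3 in auto)
      ultimately show ?thesis by simp
    qed (use assms less.prems in auto)
  qed
  from this[of 0] assms(3) show ?thesis by simp
qed

text \<open>Row \<open>i\<close> is to be the \<open>i\<close>-th iterate of
  \<open>quad_shift\<close> on row 0. Column 1 is set to 0 because
  \<open>e 1 - reflect e 1 = e 0 + 2 * e 1\<close>: then column 0 alone yields any prescribed value,
  without halving.\<close>

fun quad_shift_table :: "(nat \<Rightarrow> 'a::comm_ring_1) \<Rightarrow> nat \<Rightarrow> nat \<Rightarrow> 'a" where
  "quad_shift_table d i 0 = d i"
| "quad_shift_table d i (Suc 0) = 0"
| "quad_shift_table d i (Suc (Suc j)) = quad_shift_table d (Suc i) j - quad_shift_table d i (Suc j)"

lemma quad_shift_funpow_table: "(quad_shift ^^ i) (quad_shift_table d 0) = quad_shift_table d i"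
  by (induction i) (simp_all add: quad_shift_def fun_eq_iff)

text \<open>\<open>reflect\<close> fixes entry 0, so \<open>c\<close> cancels and only evaluation at
  \<open>a\<close> remains: these constraints hold for every choice of \<open>c\<close>.\<close>

lemma quad_shift_coeff_zero:
  "(quad_shift ^^ i) (\<lambda>j. a ^ j + c j - reflect c j) 0 = (a * (a + 1)) ^ i"
  by (simp only: quad_shift_funpow_add quad_shift_funpow_diff quad_shift_funpow_power quad_shift_funpow_reflect)
    (simp add: reflect_def)

text \<open>The converse: the constraints at entry 0 are the only ones, since the entries at 1 can
  be matched by a suitable \<open>c\<close>.\<close>

lemma exists_coeff_representation:
  fixes a :: "'a::comm_ring_1"
  assumes "\<And>i. i \<le> n \<Longrightarrow> (quad_shift ^^ i) b 0 = (a * (a + 1)) ^ i"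
  shows "\<exists>c. \<forall>j\<le>2 * n. a ^ j + c j - reflect c j = b j"
proof (intro exI allI impI)
  \<comment> \<open>What \<open>c - reflect c\<close> must contribute at entry 1 of the
    \<open>i\<close>-th iterate.\<close>
  define d where "d i = (quad_shift ^^ i) (\<lambda>j. b j - a ^ j) 1" for i
  define c where "c = quad_shift_table d 0"
  fix j assume j: "j \<le> 2 * n"
  show "a ^ j + c j - reflect c j = b j"
  proof (rule eq_if_quad_shift_eq[where N = "2 * n", OF _ _ j])
    fix i assume "2 * i \<le> 2 * n"
    then show "(quad_shift ^^ i) (\<lambda>j. a ^ j + c j - reflect c j) 0 = (quad_shift ^^ i) b 0"
      by (subst quad_shift_coeff_zero) (simp add: assms)
  next
    fix i
    have "(quad_shift ^^ i) c = quad_shift_table d i" by (simp add: c_def quad_shift_funpow_table)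
    moreover have "d i = (quad_shift ^^ i) b 1 - (a * (a + 1)) ^ i * a"
      by (simp only: d_def quad_shift_funpow_diff quad_shift_funpow_power power_one_right)
    ultimately show "(quad_shift ^^ i) (\<lambda>j. a ^ j + c j - reflect c j) 1 = (quad_shift ^^ i) b 1"
      by (simp only: quad_shift_funpow_add quad_shift_funpow_diff quad_shift_funpow_reflect quad_shift_funpow_power)
        (simp add: reflect_def)
  qed
qed

section \<open>Uniqueness and integral existence of the coefficients\<close>

lemma gen_wolstenholme_coeff_eq:
  "gen_wolstenholme_coeff k c j = (of_int k - 1) ^ j + c j - reflect c j"
  by (simp add: gen_wolstenholme_coeff_def reflect_def atMost_atLeast0)

lemma gen_wolstenholme_coeff_of_int:
  "gen_wolstenholme_coeff k (\<lambda>i. of_int (c i)) j = of_int ((k - 1) ^ j + c j - reflect c j)"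
  by (simp add: gen_wolstenholme_coeff_eq reflect_def)

lemma realizes_unique:
  assumes "realizes k n c b" "realizes k n c' b'" "j \<le> n"
  shows "b j = b' j"
proof -
  define g where "g c = (\<lambda>j. (of_int k - 1) ^ j + c j - reflect c j)" for c :: "nat \<Rightarrow> rat"
  have "(\<lambda>j. g c j - g c' j) j = 0"
  proof (rule zero_if_quad_shift_zero[of n])
    show "(quad_shift ^^ i) (\<lambda>j. g c j - g c' j) 0 = 0" for i
      unfolding quad_shift_funpow_diff unfolding g_def quad_shift_coeff_zero by simp
  qed (use assms in \<open>auto simp: realizes_def gen_wolstenholme_coeff_eq g_def\<close>)
  moreover have "g c j = b j" "g c' j = b' j"
    using assms by (auto simp: realizes_def gen_wolstenholme_coeff_eq g_def)
  ultimately show ?thesis by simp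
qed

lemma exists_integral_realization:
  obtains b c :: "nat \<Rightarrow> int"
  where "realizes k n (\<lambda>i. of_int (c i)) (\<lambda>i. of_int (b i))"
proof -
  obtain b :: "nat \<Rightarrow> int" where b: "\<forall>j>n. b j = 0"
      "\<forall>i\<le>n. (quad_shift ^^ i) b 0 = ((k - 1) * (k - 1 + 1)) ^ i"
    using exists_with_quad_shift[of 0 n "\<lambda>i. ((k - 1) * (k - 1 + 1)) ^ i"] by auto
  then obtain c where "\<forall>j\<le>2 * n. (k - 1) ^ j + c j - reflect c j = b j"
    using exists_coeff_representation[of n b "k - 1"] by blast
  with b show ?thesis
    by (intro that[of c b]) (auto simp: realizes_def gen_wolstenholme_coeff_of_int)
qed

subsection \<open>Generating polynomial of the harmonic sums\<close>

lemma H_0: "H 0 m = 1"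
proof -
  have "{is. length is = 0 \<and> sorted_wrt (>) is \<and> set is \<subseteq> {1..m}} = {[]}" by auto
  then show ?thesis by (simp add: H_def)
qed

lemma H_Suc_0: "H (Suc j) 0 = 0"
proof -
  have "{is. length is = Suc j \<and> sorted_wrt (>) is \<and> set is \<subseteq> {1..0::nat}} = {}" by auto
  then show ?thesis by (simp add: H_def)
qed

text \<open>In a decreasing tuple \<open>Suc m\<close> can only occur as the head; the tuples split
  according to whether it does.\<close>

lemma H_Suc_Suc: "H (Suc j) (Suc m) = H (Suc j) m + H j m / of_nat (Suc m)"
proof -
  define S where "S j m = {is :: nat list. length is = j \<and> sorted_wrt (>) is \<and> set is \<subseteq> {1..m}}" for j m
  define w :: "nat list \<Rightarrow> rat" where "w is = 1 / (\<Prod>i\<leftarrow>is. of_nat i)" for "is"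
  have fin: "finite (S j m)" for j m
    by (rule finite_subset[OF _ finite_lists_length_eq[of "{1..m}" j]]) (auto simp: S_def)
  have "S (Suc j) (Suc m) = S (Suc j) m \<union> (#) (Suc m) ` S j m"
  proof (intro equalityI subsetI)
    fix xs assume xs: "xs \<in> S (Suc j) (Suc m)"
    then obtain x ys where x: "xs = x # ys" by (auto simp: S_def length_Suc_conv)
    show "xs \<in> S (Suc j) m \<union> (#) (Suc m) ` S j m"
    proof (cases "x = Suc m")
      case True
      with xs x have "ys \<in> S j m" by (fastforce simp: S_def)
      then show ?thesis using x True by auto
    next
      case False
      with xs x have "xs \<in> S (Suc j) m" by (fastforce simp: S_def)
      then show ?thesis by simp
    qed
  qed (fastforce simp: S_def)+
  moreover have "S (Suc j) m \<inter> (#) (Suc m) ` S j m = {}"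
    by (auto simp: S_def)
  ultimately have "sum w (S (Suc j) (Suc m)) = sum w (S (Suc j) m) + sum w ((#) (Suc m) ` S j m)"
    using fin by (simp add: sum.union_disjoint)
  also have "sum w ((#) (Suc m) ` S j m) = (\<Sum>is\<in>S j m. w is / of_nat (Suc m))"
    by (subst sum.reindex) (auto simp: w_def mult.commute)
  finally show ?thesis
    by (simp add: H_def S_def w_def sum_divide_distrib)
qed

text \<open>Unscaled form of \<open>f\<close>: for \<open>m = p - 1\<close>, substituting
  \<open>p * x\<close> for the variable gives \<open>f\<close>.\<close>

definition harmonic_poly :: "nat \<Rightarrow> rat poly" where
  "harmonic_poly m = (\<Prod>i=1..m. [:1, 1 / of_nat i:])"

lemma coeff_harmonic_poly: "coeff (harmonic_poly m) j = H j m"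
proof (induction m arbitrary: j)
  case 0
  then show ?case by (cases j) (simp_all add: harmonic_poly_def H_0 H_Suc_0)
next
  case (Suc m)
  have "harmonic_poly (Suc m) = harmonic_poly m + pCons 0 (smult (1 / of_nat (Suc m)) (harmonic_poly m))"
    by (simp add: harmonic_poly_def mult.commute)
  then show ?case
    by (cases j) (simp_all add: Suc.IH H_0 H_Suc_Suc)
qed

lemma degree_harmonic_poly: "degree (harmonic_poly m) \<le> m"
proof -
  have "degree (harmonic_poly m) \<le> (\<Sum>i=1..m. degree [:1, 1 / of_nat i :: rat:])"
    unfolding harmonic_poly_def
    using degree_prod_sum_le[of "{1..m}" "\<lambda>i. [:1, 1 / of_nat i :: rat:]"] by (simp add: o_def)
  also have "\<dots> \<le> (\<Sum>i=1..m. 1)" by (intro sum_mono) simp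
  finally show ?thesis by simp
qed

lemma H_eq_0: "m < j \<Longrightarrow> H j m = 0"
  using degree_harmonic_poly[of m] coeff_eq_0[of "harmonic_poly m" j]
  by (simp add: coeff_harmonic_poly)

lemma poly_harmonic_poly_gchoose: "poly (harmonic_poly m) x = (x + of_nat m) gchoose m"
proof -
  have "poly (harmonic_poly m) x = pochhammer (x + 1) m / fact m"
  proof (induction m)
    case (Suc m)
    have "poly (harmonic_poly (Suc m)) x = poly (harmonic_poly m) x * (1 + x / of_nat (Suc m))"
      by (simp add: harmonic_poly_def algebra_simps)
    also have "1 + x / of_nat (Suc m) = (x + 1 + of_nat m) / of_nat (Suc m)"
      by (simp add: field_simps del: of_nat_Suc)
    finally show ?case
      by (simp only: Suc.IH pochhammer_Suc fact_Suc times_divide_times_eq) (simp add: mult.commute)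
  qed (simp add: harmonic_poly_def)
  then show ?thesis by (simp add: gbinomial_pochhammer')
qed

lemma poly_harmonic_poly_sum: "poly (harmonic_poly m) x = (\<Sum>j\<le>m. H j m * x ^ j)"
proof -
  have "poly (harmonic_poly m) x = (\<Sum>j\<le>degree (harmonic_poly m). H j m * x ^ j)"
    by (simp add: poly_altdef coeff_harmonic_poly)
  also have "\<dots> = (\<Sum>j\<le>m. H j m * x ^ j)"
    using degree_harmonic_poly[of m]
    by (intro sum.mono_neutral_left) (auto simp: coeff_eq_0 simp flip: coeff_harmonic_poly)
  finally show ?thesis .
qed

lemma pcompose_monom: "pcompose (monom a i) q = smult a (q ^ i)"
  for a :: "'a::comm_ring_1"
  by (induction i) (simp_all add: monom_0 monom_Suc pcompose_pCons)

lemma coeff_pcompose_linear: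
  fixes q :: "'a::comm_ring_1 poly"
  assumes "degree q \<le> m"
  shows "coeff (pcompose q [:a, b:]) j =
    (\<Sum>i\<le>m. coeff q i * (of_nat (i choose j) * b ^ j * a ^ (i - j)))"
proof -
  have "pcompose q [:a, b:] = (\<Sum>i\<le>m. pcompose (monom (coeff q i) i) [:a, b:])"
    by (subst poly_as_sum_of_monoms'[OF assms, symmetric]) (simp add: pcompose_sum)
  also have "\<dots> = (\<Sum>i\<le>m. smult (coeff q i) ([:a, b:] ^ i))"
    by (simp add: pcompose_monom)
  finally have "coeff (pcompose q [:a, b:]) j = (\<Sum>i\<le>m. coeff q i * coeff ([:a, b:] ^ i) j)"
    by (simp add: coeff_sum)
  moreover have "coeff ([:a, b:] ^ i) j = of_nat (i choose j) * b ^ j * a ^ (i - j)" for i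
  proof (cases "j \<le> i")
    case False
    have "degree ([:a, b:] ^ i) \<le> 1 * i"
      by (rule order_trans[OF degree_power_le]) simp
    with False show ?thesis by (simp add: coeff_eq_0 binomial_eq_0)
  qed (rule coeff_linear_poly_power)
  ultimately show ?thesis by simp
qed

text \<open>Up to sign the substitution exchanges the factors \<open>i + x\<close> and
  \<open>Suc m - i + x\<close>; in binomial form this is upper negation.\<close>

lemma harmonic_poly_reflect:
  "pcompose (harmonic_poly m) [:- of_nat (Suc m), -1:] = smult ((-1) ^ m) (harmonic_poly m)"
proof -
  have "poly (pcompose (harmonic_poly m) [:- of_nat (Suc m), -1:]) x
      = poly (smult ((-1) ^ m) (harmonic_poly m)) x" for x
    using gbinomial_minus[of "x + 1" m]
    by (simp add: poly_pcompose poly_harmonic_poly_gchoose algebra_simps)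
  then show ?thesis by (auto simp flip: poly_eq_poly_eq_iff)
qed

text \<open>Up to the factor \<open>m!\<close>, both sides are
  \<open>(x + 1) (x + 2) ... (x + m + 1)\<close>.\<close>

lemma harmonic_poly_shift:
  "[:of_nat (Suc m), 1:] * harmonic_poly m = [:1, 1:] * pcompose (harmonic_poly m) [:1, 1:]"
proof -
  have "poly ([:of_nat (Suc m), 1:] * harmonic_poly m) x
      = poly ([:1, 1:] * pcompose (harmonic_poly m) [:1, 1:]) x" for x
  proof -
    have "(x + of_nat m + 1 - of_nat m) * ((x + of_nat m + 1) gchoose m)
        = (x + of_nat m + 1) * ((x + of_nat m) gchoose m)"
      using gbinomial_absorb_comp[of "x + of_nat m + 1" m] by simp
    then show ?thesis
      by (simp add: poly_pcompose poly_harmonic_poly_gchoose algebra_simps)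
  qed
  then show ?thesis by (auto simp flip: poly_eq_poly_eq_iff)
qed

lemma H_reflect:
  "(-1) ^ m * (of_nat (Suc m) ^ j * H j m)
     = (\<Sum>i\<le>m. (-1) ^ i * of_nat (i choose j) * (of_nat (Suc m) ^ i * H i m))"
proof -
  have "(-1) ^ m * H j m = (\<Sum>i\<le>m. H i m * (of_nat (i choose j) * (-1) ^ j * (- of_nat (Suc m)) ^ (i - j)))"
    using coeff_pcompose_linear[OF degree_harmonic_poly, of m "- of_nat (Suc m)" "-1" j]
    by (simp only: harmonic_poly_reflect coeff_smult coeff_harmonic_poly)
  then have "(-1) ^ m * (of_nat (Suc m) ^ j * H j m) = of_nat (Suc m) ^ j *
     (\<Sum>i\<le>m. H i m * (of_nat (i choose j) * (-1) ^ j * (- of_nat (Suc m)) ^ (i - j)))"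
    by (subst mult.left_commute) (rule arg_cong)
  also have "\<dots> = (\<Sum>i\<le>m. (-1) ^ i * of_nat (i choose j) * (of_nat (Suc m) ^ i * H i m))"
    unfolding sum_distrib_left
  proof (rule sum.cong)
    fix i
    show "of_nat (Suc m) ^ j * (H i m * (of_nat (i choose j) * (-1) ^ j * (- of_nat (Suc m)) ^ (i - j)))
        = (-1) ^ i * of_nat (i choose j) * (of_nat (Suc m) ^ i * H i m)"
    proof (cases "j \<le> i")
      case True
      then obtain l where "i = j + l" using le_Suc_ex by blast
      moreover have "(- of_nat (Suc m)) ^ l = (-1) ^ l * (of_nat (Suc m) :: rat) ^ l"
        by (rule power_minus)
      ultimately show ?thesis by (simp only: power_add) simp
    qed (simp add: binomial_eq_0)
  qed simp
  finally show ?thesis .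
qed

text \<open>Comparison of coefficients in \<open>harmonic_poly_shift\<close>, where the term
  \<open>i = j\<close> cancels \<open>H j m\<close>. For \<open>Suc m = p\<close> the left side has
  the factor \<open>p\<close>, the source of the divisibility of harmonic sums.\<close>

lemma H_shift:
  "of_nat (Suc m) * H (Suc j) m = (\<Sum>i=Suc j..m. of_nat (Suc i choose Suc j) * H i m)"
proof -
  let ?F = "pcompose (harmonic_poly m) [:1, 1:]"
  have F: "coeff ?F l = (\<Sum>i\<le>m. of_nat (i choose l) * H i m)" for l
    by (subst coeff_pcompose_linear[OF degree_harmonic_poly]) (simp add: coeff_harmonic_poly mult.commute)
  have "coeff ([:of_nat (Suc m), 1:] * harmonic_poly m) (Suc j) = coeff ([:1, 1:] * ?F) (Suc j)"
    by (simp only: harmonic_poly_shift)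
  then have "of_nat (Suc m) * H (Suc j) m + H j m = coeff ?F (Suc j) + coeff ?F j"
    by (simp add: coeff_harmonic_poly algebra_simps)
  also have "\<dots> = (\<Sum>i\<le>m. of_nat (Suc i choose Suc j) * H i m)"
    by (simp add: F sum.distrib algebra_simps)
  also have "\<dots> = (\<Sum>i\<in>{j..m}. of_nat (Suc i choose Suc j) * H i m)"
    by (intro sum.mono_neutral_right) (auto simp: binomial_eq_0)
  also have "\<dots> = H j m + (\<Sum>i=Suc j..m. of_nat (Suc i choose Suc j) * H i m)"
    by (cases "j \<le> m") (simp_all add: sum.atLeast_Suc_atMost H_eq_0)
  finally show ?thesis by simp
qed

text \<open>By the symmetry of \<open>f\<close>, the functionals \<open>c\<close> and
  \<open>reflect c\<close> agree on it, so adding their difference to evaluation at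
  \<open>k - 1\<close> leaves the value unchanged.\<close>

lemma gbinomial_eq_sum_gen_wolstenholme_coeff:
  assumes "odd p"
  shows "(of_int (k * int p - 1) :: rat) gchoose (p - 1)
    = (\<Sum>j\<le>p - 1. gen_wolstenholme_coeff k c j * (of_nat p ^ j * H j (p - 1)))"
proof -
  from assms obtain m where m: "p = Suc m" "even m" by (cases p) auto
  define h where "h j = of_nat p ^ j * H j m" for j
  have "(\<Sum>j\<le>m. reflect c j * h j) = (\<Sum>j\<le>m. \<Sum>i\<le>m. (-1) ^ j * of_nat (j choose i) * c i * h j)"
  proof (rule sum.cong[OF refl])
    fix j assume "j \<in> {..m}"
    then have "(\<Sum>i\<le>j. of_nat (j choose i) * c i) = (\<Sum>i\<le>m. of_nat (j choose i) * c i)"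
      by (intro sum.mono_neutral_left) (auto simp: binomial_eq_0)
    then show "reflect c j * h j = (\<Sum>i\<le>m. (-1) ^ j * of_nat (j choose i) * c i * h j)"
      by (simp only: reflect_def sum_distrib_left sum_distrib_right mult.assoc)
  qed
  also have "\<dots> = (\<Sum>i\<le>m. c i * (\<Sum>j\<le>m. (-1) ^ j * of_nat (j choose i) * h j))"
    by (subst sum.swap) (simp add: sum_distrib_left mult_ac)
  moreover have "(\<Sum>j\<le>m. (-1) ^ j * of_nat (j choose i) * h j) = h i" for i
    unfolding h_def m(1) using H_reflect[of m i, symmetric] m(2) by (simp only: uminus_power_if power_one if_True mult_1)
  ultimately have R: "(\<Sum>j\<le>m. reflect c j * h j) = (\<Sum>i\<le>m. c i * h i)" by simp
  \<comment> \<open>The evaluation point comes from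
    \<open>(k - 1) * p + (p - 1) = k * p - 1\<close>.\<close>
  have "(of_int (k * int p - 1) :: rat) gchoose m
      = poly (harmonic_poly m) ((of_int k - 1) * of_nat p)"
    by (simp add: poly_harmonic_poly_gchoose m algebra_simps)
  also have "\<dots> = (\<Sum>j\<le>m. (of_int k - 1) ^ j * h j)"
    unfolding poly_harmonic_poly_sum h_def power_mult_distrib by (intro sum.cong) simp_all
  also have "\<dots> = (\<Sum>j\<le>m. gen_wolstenholme_coeff k c j * h j)"
    using R by (simp add: gen_wolstenholme_coeff_eq algebra_simps sum.distrib sum_subtractf)
  finally show ?thesis by (simp add: m h_def)
qed

subsection \<open>Divisibility by prime powers\<close>

text \<open>Membership in \<open>p ^ m\<close> times the localization of the integers at
  \<open>p\<close>; \<open>m = 0\<close> is \<open>p\<close>-integrality. The fraction need not be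
  reduced, so closure properties follow by cross-multiplication.\<close>

definition padic_dvd :: "nat \<Rightarrow> nat \<Rightarrow> rat \<Rightarrow> bool" where
  "padic_dvd p m x \<longleftrightarrow> (\<exists>a b. \<not> int p dvd b \<and> x * of_int b = of_int (int p ^ m * a))"

lemma padic_dvd_of_int: "prime p \<Longrightarrow> int p ^ m dvd a \<Longrightarrow> padic_dvd p m (of_int a)"
  unfolding padic_dvd_def by (rule exI[of _ "a div int p ^ m"], rule exI[of _ 1]) auto

lemma not_dvd_mult:
  "prime p \<Longrightarrow> \<not> int p dvd a \<Longrightarrow> \<not> int p dvd b \<Longrightarrow> \<not> int p dvd a * b"
  by (simp add: prime_dvd_mult_iff)

lemma padic_dvd_0: "prime p \<Longrightarrow> padic_dvd p m 0"
  using padic_dvd_of_int[of p m 0] by simp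

lemma padic_dvd_add:
  assumes "prime p" "padic_dvd p m x" "padic_dvd p m y"
  shows "padic_dvd p m (x + y)"
proof -
  from assms obtain a b c d where
    x: "\<not> int p dvd b" "x * of_int b = of_int (int p ^ m * a)" and
    y: "\<not> int p dvd d" "y * of_int d = of_int (int p ^ m * c)"
    unfolding padic_dvd_def by blast
  have "(x + y) * of_int (b * d) = (x * of_int b) * of_int d + (y * of_int d) * of_int b"
    by (simp add: algebra_simps)
  also have "\<dots> = of_int (int p ^ m * (a * d + c * b))"
    unfolding x y by (simp add: algebra_simps)
  finally show ?thesis
    using not_dvd_mult[OF assms(1) x(1) y(1)] unfolding padic_dvd_def by blast
qed

lemma padic_dvd_mult:
  assumes "prime p" "padic_dvd p m x" "padic_dvd p l y"
  shows "padic_dvd p (m + l) (x * y)"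
proof -
  from assms obtain a b c d where
    x: "\<not> int p dvd b" "x * of_int b = of_int (int p ^ m * a)" and
    y: "\<not> int p dvd d" "y * of_int d = of_int (int p ^ l * c)"
    unfolding padic_dvd_def by blast
  have "(x * y) * of_int (b * d) = (x * of_int b) * (y * of_int d)"
    by (simp add: algebra_simps)
  also have "\<dots> = of_int (int p ^ (m + l) * (a * c))"
    unfolding x y by (simp add: algebra_simps power_add)
  finally show ?thesis
    using not_dvd_mult[OF assms(1) x(1) y(1)] unfolding padic_dvd_def by blast
qed

lemma padic_dvd_mono:
  assumes "padic_dvd p m x" "l \<le> m"
  shows "padic_dvd p l x"
proof -
  from assms(1) obtain a b where b: "\<not> int p dvd b" "x * of_int b = of_int (int p ^ m * a)"
    unfolding padic_dvd_def by blast
  have "int p ^ m * a = int p ^ l * (int p ^ (m - l) * a)"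
    using assms(2) by (simp flip: power_add mult.assoc)
  with b show ?thesis unfolding padic_dvd_def by metis
qed

lemma padic_dvd_of_int_mult:
  "prime p \<Longrightarrow> padic_dvd p m x \<Longrightarrow> padic_dvd p m (of_int a * x)"
  using padic_dvd_mult[of p 0 "of_int a" m x] padic_dvd_of_int[of p 0 a] by simp

lemma padic_dvd_uminus: "prime p \<Longrightarrow> padic_dvd p m x \<Longrightarrow> padic_dvd p m (- x)"
  using padic_dvd_of_int_mult[of p m x "-1"] by simp

lemma padic_dvd_sum:
  assumes "prime p" "\<And>i. i \<in> A \<Longrightarrow> padic_dvd p m (f i)"
  shows "padic_dvd p m (sum f A)"
  using assms(2)
  by (induction A rule: infinite_finite_induct) (simp_all add: assms(1) padic_dvd_0 padic_dvd_add)

lemma padic_dvd_cancel: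
  assumes "prime p" "\<not> int p dvd a" "padic_dvd p m (of_int a * x)"
  shows "padic_dvd p m x"
proof -
  from assms(3) obtain c b where "\<not> int p dvd b" "of_int a * x * of_int b = of_int (int p ^ m * c)"
    unfolding padic_dvd_def by blast
  then have "x * of_int (a * b) = of_int (int p ^ m * c)" "\<not> int p dvd a * b"
    using assms(1,2) by (simp_all add: mult_ac prime_dvd_mult_iff)
  then show ?thesis unfolding padic_dvd_def by blast
qed

text \<open>The reduced denominator divides every other denominator, so it stays prime to
  \<open>p\<close>.\<close>

lemma padic_dvd_quotient_of:
  assumes "prime p" "padic_dvd p m x"
  shows "\<not> int p dvd snd (quotient_of x)" "int p ^ m dvd fst (quotient_of x)"
proof -
  obtain u v where uv: "quotient_of x = (u, v)" by (cases "quotient_of x")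
  then have v: "v > 0" "coprime u v" "x = of_int u / of_int v"
    by (simp_all add: quotient_of_denom_pos quotient_of_coprime quotient_of_div)
  from assms(2) obtain a b where b: "\<not> int p dvd b" "x * of_int b = of_int (int p ^ m * a)"
    unfolding padic_dvd_def by blast
  then have "of_int (u * b) = (of_int (int p ^ m * a * v) :: rat)"
    using v(1,3) by (simp add: field_simps)
  then have eq: "u * b = int p ^ m * a * v" by (simp only: of_int_eq_iff)
  then have "v dvd b" using v(2)
    by (metis coprime_commute coprime_dvd_mult_right_iff dvd_triv_right)
  then show "\<not> int p dvd snd (quotient_of x)" using b(1) uv by auto
  have "coprime (int p ^ m) b"
    using prime_imp_coprime[of "int p" b] assms(1) b(1) by simp
  moreover have "int p ^ m dvd u * b" by (simp add: eq)
  ultimately show "int p ^ m dvd fst (quotient_of x)"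
    using uv by (simp add: coprime_dvd_mult_left_iff)
qed

lemma rat_cong_if_padic_dvd:
  assumes p: "prime p" and "padic_dvd p 0 x" "padic_dvd p 0 y" and d: "padic_dvd p m (x - y)"
  shows "rat_cong p m x y"
proof -
  have int: "p_integral p z" if "padic_dvd p 0 z" for z
    unfolding p_integral_def by (rule prime_imp_coprime) (use padic_dvd_quotient_of(1)[OF p that] p in simp_all)
  have "int m \<le> padic_val p (x - y)" if "x \<noteq> y"
  proof -
    have "fst (quotient_of (x - y)) \<noteq> 0"
      using that quotient_of_div[of "x - y"] by (cases "quotient_of (x - y)") auto
    then have "m \<le> multiplicity (int p) (fst (quotient_of (x - y)))"
      using padic_dvd_quotient_of(2)[OF p d] p by (intro multiplicity_geI) (auto simp: prime_gt_1_nat)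
    then show ?thesis
      using padic_dvd_quotient_of(1)[OF p d] by (simp add: padic_val_def not_dvd_imp_multiplicity_0)
  qed
  with int assms(2,3) show ?thesis unfolding rat_cong_def by blast
qed

section \<open>Divisibility of the harmonic sums and of the tail terms\<close>

lemma padic_dvd_H:
  assumes "prime p" "m < p"
  shows "padic_dvd p 0 (H j m)"
  using assms(2)
proof (induction m arbitrary: j)
  case 0
  then show ?case
    using padic_dvd_of_int[OF assms(1), of 0 1]
    by (cases j) (auto simp: H_0 H_Suc_0 intro: padic_dvd_0[OF assms(1)])
next
  case (Suc m)
  have nd: "\<not> int p dvd int (Suc m)"
    using Suc.prems by (metis int_dvd_int_iff dvd_imp_le not_le zero_less_Suc)
  show ?case
  proof (cases j)
    case 0
    then show ?thesis using padic_dvd_of_int[OF assms(1), of 0 1] by (simp add: H_0)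
  next
    case (Suc l)
    have "padic_dvd p 0 (H l m / of_nat (Suc m))"
      by (rule padic_dvd_cancel[OF assms(1) nd]) (use Suc.IH[of l] Suc.prems in simp)
    then show ?thesis
      using padic_dvd_add[OF assms(1) Suc.IH[of "Suc l"]] Suc.prems by (simp add: Suc H_Suc_Suc)
  qed
qed

text \<open>Downward induction on \<open>j\<close> through \<open>H_shift\<close> with
  \<open>Suc m = p\<close>: the left side has the factor \<open>p\<close>, the term
  \<open>i = p - 1\<close> has the coefficient \<open>p choose j\<close>, and the terms between are
  covered by induction. What remains is \<open>(j + 1) * H j (p - 1)\<close>, with
  \<open>j + 1 < p\<close> prime to \<open>p\<close>.\<close>

lemma padic_dvd_1_H:
  assumes p: "prime p" and "1 \<le> j" "j + 2 \<le> p"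
  shows "padic_dvd p 1 (H j (p - 1))"
  using assms(2,3)
proof (induction "p - j" arbitrary: j rule: less_induct)
  case less
  define m where "m = p - 1"
  from less.prems have m: "p = Suc m" and jm: "j < m" by (auto simp: m_def)
  obtain l where l: "j = Suc l" using less.prems by (cases j) auto
  have p1: "padic_dvd p 1 (of_int (int p * a) * x)" if "padic_dvd p 0 x" for a x
    using padic_dvd_mult[OF p, of 1 "of_int (int p * a)" 0 x] padic_dvd_of_int[OF p, of 1 "int p * a"] that
    by simp
  have int: "padic_dvd p 0 (H i m)" for i by (rule padic_dvd_H[OF p]) (simp add: m)
  have "of_nat p * H j m = (\<Sum>i=j..m. of_nat (Suc i choose j) * H i m)"
    using H_shift[of m l] by (simp add: m l)
  also have "\<dots> = of_nat (Suc j) * H j m + (\<Sum>i=Suc j..m. of_nat (Suc i choose j) * H i m)"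
    using jm by (simp add: sum.atLeast_Suc_atMost)
  finally have "of_int (int (Suc j)) * H j m
      = of_int (int p * 1) * H j m + - (\<Sum>i=Suc j..m. of_nat (Suc i choose j) * H i m)"
    by simp
  moreover have "padic_dvd p 1 (of_nat (Suc i choose j) * H i m)" if i: "i \<in> {Suc j..m}" for i
  proof (cases "i = m")
    case True
    have "p dvd (p choose j)"
      using less.prems by (intro dvd_choose_prime p) auto
    then obtain a where "p choose j = p * a" ..
    then show ?thesis using p1[OF int, of "int a" i] True by (simp add: m algebra_simps)
  next
    case False
    then have "padic_dvd p 1 (H i (p - 1))"
      using i less.prems by (intro less.hyps) (auto simp: m)
    then show ?thesis
      using padic_dvd_of_int_mult[OF p, of 1 "H i m" "int (Suc i choose j)"] by (simp add: m)
  qed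
  ultimately have "padic_dvd p 1 (of_int (int (Suc j)) * H j m)"
    using p1[OF int, of 1 j] by (simp only:) (intro padic_dvd_add padic_dvd_uminus padic_dvd_sum p; blast)
  moreover have "\<not> int p dvd int (Suc j)"
    using less.prems by (metis int_dvd_int_iff dvd_imp_le not_less_eq_eq add_2_eq_Suc' zero_less_Suc)
  ultimately show ?case
    using padic_dvd_cancel[OF p] unfolding m_def by blast
qed

lemma padic_dvd_power_mult:
  assumes "prime p" "padic_dvd p l x"
  shows "padic_dvd p (m + l) (of_nat p ^ m * x)"
  using padic_dvd_mult[OF assms(1) _ assms(2), of m "of_nat p ^ m"] padic_dvd_of_int[OF assms(1), of m "int p ^ m"]
  by simp

lemma padic_dvd_term:
  assumes "prime p" "m \<le> j"
  shows "padic_dvd p m (of_nat p ^ j * H j (p - 1))"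
  using padic_dvd_power_mult[OF assms(1) padic_dvd_H[OF assms(1)], of "p - 1" j]
    prime_gt_0_nat[OF assms(1)] padic_dvd_mono[OF _ assms(2)]
  by simp

lemma padic_dvd_term_beyond:
  assumes "prime p" "p \<le> j"
  shows "padic_dvd p m (of_nat p ^ j * H j (p - 1))"
proof -
  have "H j (p - 1) = 0" using assms prime_gt_0_nat[of p] by (intro H_eq_0) auto
  then show ?thesis using assms(1) by (simp only: mult_zero_right padic_dvd_0)
qed

text \<open>For odd \<open>j\<close> the reflection identity expresses twice the term of index \<open>j\<close> through the later terms.\<close>

lemma padic_dvd_odd_H:
  assumes p: "prime p" "odd p" and j: "odd j"
    and later: "\<And>i. j < i \<Longrightarrow> i < p \<Longrightarrow> padic_dvd p m (of_nat p ^ i * H i (p - 1))"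
  shows "padic_dvd p m (of_nat p ^ j * H j (p - 1))"
proof (cases "j < p")
  case False
  then show ?thesis using p by (intro padic_dvd_term_beyond) auto
next
  case True
  define q where "q = p - 1"
  have q: "p = Suc q" "even q" using True p(2) by (auto simp: q_def)
  define h where "h i = of_nat p ^ i * H i q" for i
  have "h j = (\<Sum>i\<le>q. (-1) ^ i * of_nat (i choose j) * h i)"
    unfolding h_def q(1) using H_reflect[of q j] q(2) by (simp only: uminus_power_if power_one if_True mult_1)
  also have "\<dots> = (\<Sum>i\<in>{j..q}. (-1) ^ i * of_nat (i choose j) * h i)"
    by (intro sum.mono_neutral_right) (auto simp: binomial_eq_0)
  also have "\<dots> = - h j + (\<Sum>i\<in>{Suc j..q}. of_int ((-1) ^ i * int (i choose j)) * h i)"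
    using True q j by (simp add: sum.atLeast_Suc_atMost)
  finally have "of_int 2 * h j = (\<Sum>i\<in>{Suc j..q}. of_int ((-1) ^ i * int (i choose j)) * h i)"
    by simp
  moreover have "padic_dvd p m (\<Sum>i\<in>{Suc j..q}. of_int ((-1) ^ i * int (i choose j)) * h i)"
    using later q by (intro padic_dvd_sum padic_dvd_of_int_mult p) (auto simp: h_def)
  moreover have "\<not> int p dvd 2"
    using p by (metis dvd_trans even_numeral int_dvd_int_iff of_nat_numeral primes_dvd_imp_eq two_is_prime_nat)
  ultimately have "padic_dvd p m (h j)"
    using padic_dvd_cancel[OF p(1)] by metis
  then show ?thesis by (simp add: h_def q)
qed

lemma padic_dvd_tail:
  assumes p: "prime p" "odd p" "p \<noteq> 2 * n + 3" and j: "2 * n < j"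
  shows "padic_dvd p (2 * n + 3) (of_nat p ^ j * H j (p - 1))"
proof -
  have *: "padic_dvd p (2 * n + 3) (of_nat p ^ j * H j (p - 1))" if "2 * n + 1 < j" for j
  proof -
    consider "p \<le> j" | "j + 1 = p" | "j + 2 \<le> p" by linarith
    then show ?thesis
    proof cases
      case 1
      then show ?thesis by (intro padic_dvd_term_beyond p)
    next
      case 2
      \<comment> \<open>\<open>H (p - 1) (p - 1)\<close> offers no extra factor \<open>p\<close>,
        but \<open>p \<noteq> 2 * n + 3\<close> excludes \<open>j = 2 * n + 2\<close>, so
        \<open>p ^ j\<close> is enough.\<close>
      with that p have "2 * n + 3 \<le> j" by auto
      then show ?thesis by (intro padic_dvd_term p)
    next
      case 3
      then have "padic_dvd p 1 (H j (p - 1))"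
        using that by (intro padic_dvd_1_H p) auto
      then show ?thesis
        using padic_dvd_mono[OF padic_dvd_power_mult[OF p(1), of 1 _ j], of _ "2 * n + 3"] that by simp
    qed
  qed
  show ?thesis
  proof (cases "j = 2 * n + 1")
    case True
    then show ?thesis by (intro padic_dvd_odd_H[OF p(1,2) _ *]) auto
  qed (use * j in auto)
qed

text \<open>Here index \<open>2 * n + 2\<close> equals \<open>p - 1\<close>, where only
  \<open>p ^ j\<close> itself is available; this costs one power of \<open>p\<close>.\<close>

lemma padic_dvd_tail_exceptional:
  assumes p: "prime p" "p = 2 * n + 3" and j: "2 * n < j"
  shows "padic_dvd p (2 * n + 2) (of_nat p ^ j * H j (p - 1))"
proof -
  have *: "padic_dvd p (2 * n + 2) (of_nat p ^ j * H j (p - 1))" if "2 * n + 1 < j" for j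
    using that by (intro padic_dvd_term p) simp
  show ?thesis
  proof (cases "j = 2 * n + 1")
    case True
    then show ?thesis using p(2) by (intro padic_dvd_odd_H[OF p(1) _ _ *]) auto
  qed (use * j in auto)
qed

section \<open>The truncated sum and its error term\<close>

lemma gbinomial_eq_truncated_sum:
  assumes "odd p" and r: "realizes k n c b"
  shows "(of_int (k * int p - 1) :: rat) gchoose (p - 1)
    = (\<Sum>j=0..n. b j * of_nat p ^ j * H j (p - 1))
      + (\<Sum>j\<in>{2 * n<..<p}. gen_wolstenholme_coeff k c j * (of_nat p ^ j * H j (p - 1)))"
proof -
  let ?g = "\<lambda>j. gen_wolstenholme_coeff k c j * (of_nat p ^ j * H j (p - 1))"
  have p: "0 < p" using assms(1) by (cases p) auto
  have "(of_int (k * int p - 1) :: rat) gchoose (p - 1) = sum ?g {..p - 1}"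
    by (rule gbinomial_eq_sum_gen_wolstenholme_coeff[OF assms(1)])
  \<comment> \<open>Enlarging the range also covers \<open>p - 1 < 2 * n\<close>; the added terms
    have \<open>H j (p - 1) = 0\<close>.\<close>
  also have "\<dots> = sum ?g ({..2 * n} \<union> {2 * n<..<p})"
    using p by (intro sum.mono_neutral_left) (auto simp: H_eq_0)
  also have "\<dots> = sum ?g {..2 * n} + sum ?g {2 * n<..<p}"
    by (intro sum.union_disjoint) auto
  also have "sum ?g {..2 * n} = sum ?g {0..n}"
    using r by (intro sum.mono_neutral_right) (auto simp: realizes_def)
  also have "\<dots> = (\<Sum>j=0..n. b j * of_nat p ^ j * H j (p - 1))"
    using r by (intro sum.cong) (auto simp: realizes_def)
  finally show ?thesis .
qed

lemma rat_cong_truncated_sum: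
  assumes p: "prime p" "odd p" and r: "realizes k n (\<lambda>i. of_int (c i)) (\<lambda>i. of_int (b i))"
    and tail: "\<And>j. 2 * n < j \<Longrightarrow> padic_dvd p m (of_nat p ^ j * H j (p - 1))"
  shows "rat_cong p m ((of_int (k * int p - 1) :: rat) gchoose (p - 1))
    (\<Sum>j=0..n. of_int (b j) * of_nat p ^ j * H j (p - 1))"
    (is "rat_cong p m ?x ?y")
proof -
  let ?t = "\<Sum>j\<in>{2 * n<..<p}. gen_wolstenholme_coeff k (\<lambda>i. of_int (c i)) j * (of_nat p ^ j * H j (p - 1))"
  have x: "?x = ?y + ?t" by (rule gbinomial_eq_truncated_sum[OF p(2) r])
  \<comment> \<open>The coefficients beyond \<open>2 * n\<close> are integers because
    \<open>c\<close> is integral, so the tail is bounded term by term.\<close>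
  have t: "padic_dvd p m ?t"
    unfolding gen_wolstenholme_coeff_of_int
    by (intro padic_dvd_sum padic_dvd_of_int_mult p tail) auto
  have y: "padic_dvd p 0 ?y"
    unfolding mult.assoc
    by (intro padic_dvd_sum padic_dvd_of_int_mult padic_dvd_term p) simp
  show ?thesis
  proof (rule rat_cong_if_padic_dvd[OF p(1)])
    show "padic_dvd p 0 ?x"
      unfolding x by (intro padic_dvd_add p y padic_dvd_mono[OF t]) simp
    show "padic_dvd p m (?x - ?y)" using t by (simp only: x add_diff_cancel_left')
  qed (rule y)
qed

theorem theorem4p1:
  fixes k :: int and n :: nat
  shows "\<exists>b :: nat \<Rightarrow> rat.
    (\<exists>c :: nat \<Rightarrow> rat. realizes k n c b) \<and>
    (\<forall>b' :: nat \<Rightarrow> rat. (\<exists>c :: nat \<Rightarrow> rat. realizes k n c b') \<longrightarrow> (\<forall>j\<in>{0..n}. b' j = b j)) \<and>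
    (\<exists>c :: nat \<Rightarrow> rat. (\<forall>j. c j \<in> \<int>) \<and> realizes k n c b) \<and>
    (\<forall>j\<in>{0..n}. b j \<in> \<int>) \<and>
    (\<forall>p :: nat. prime p \<and> odd p \<and> p \<noteq> 2 * n + 3 \<longrightarrow>
       rat_cong p (2 * n + 3)
         ((of_int (k * int p - 1) :: rat) gchoose (p - 1))
         (\<Sum>j=0..n. b j * of_nat p ^ j * H j (p - 1))) \<and>
    (\<forall>p :: nat. prime p \<and> p = 2 * n + 3 \<longrightarrow>
       rat_cong p (2 * n + 2)
         ((of_int (k * int p - 1) :: rat) gchoose (p - 1))
         (\<Sum>j=0..n. b j * of_nat p ^ j * H j (p - 1))) \<and>
    (\<forall>p :: nat. prime p \<and> odd p \<and> p \<le> 2 * n + 1 \<longrightarrow>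
       ((of_int (k * int p - 1) :: rat) gchoose (p - 1)) =
         (\<Sum>j=0..n. b j * of_nat p ^ j * H j (p - 1)))"
proof -
  obtain b c :: "nat \<Rightarrow> int"
    where r: "realizes k n (\<lambda>i. of_int (c i)) (\<lambda>i. of_int (b i))"
    by (rule exists_integral_realization)
  show ?thesis
  proof (rule exI[of _ "\<lambda>i. of_int (b i)"], intro conjI)
    show "\<exists>c. realizes k n c (\<lambda>i. of_int (b i))" using r by blast
    show "\<exists>c. (\<forall>j. c j \<in> \<int>) \<and> realizes k n c (\<lambda>i. of_int (b i))"
      using r by (intro exI[of _ "\<lambda>i. of_int (c i)"]) simp
    show "\<forall>b'. (\<exists>c. realizes k n c b') \<longrightarrow> (\<forall>j\<in>{0..n}. b' j = of_int (b j))"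
      using realizes_unique[OF _ r] by auto
  next
    show "\<forall>p. prime p \<and> odd p \<and> p \<le> 2 * n + 1 \<longrightarrow>
       ((of_int (k * int p - 1) :: rat) gchoose (p - 1)) =
         (\<Sum>j=0..n. of_int (b j) * of_nat p ^ j * H j (p - 1))"
    proof (intro allI impI)
      fix p :: nat assume "prime p \<and> odd p \<and> p \<le> 2 * n + 1"
      \<comment> \<open>No index lies strictly between \<open>2 * n\<close> and \<open>p\<close>, so
        the error term is an empty sum.\<close>
      then have "odd p" and "{2 * n<..<p} = {}" by auto
      with gbinomial_eq_truncated_sum[OF this(1) r]
      show "((of_int (k * int p - 1) :: rat) gchoose (p - 1)) =
         (\<Sum>j=0..n. of_int (b j) * of_nat p ^ j * H j (p - 1))" by simp
    qed
    show "\<forall>p. prime p \<and> odd p \<and> p \<noteq> 2 * n + 3 \<longrightarrow>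
       rat_cong p (2 * n + 3) ((of_int (k * int p - 1) :: rat) gchoose (p - 1))
         (\<Sum>j=0..n. of_int (b j) * of_nat p ^ j * H j (p - 1))"
      by (intro allI impI rat_cong_truncated_sum[OF _ _ r] padic_dvd_tail) blast+
    show "\<forall>p. prime p \<and> p = 2 * n + 3 \<longrightarrow>
       rat_cong p (2 * n + 2) ((of_int (k * int p - 1) :: rat) gchoose (p - 1))
         (\<Sum>j=0..n. of_int (b j) * of_nat p ^ j * H j (p - 1))"
    proof (intro allI impI)
      fix p assume p: "prime p \<and> p = 2 * n + 3"
      then have "odd p" by simp
      with p show "rat_cong p (2 * n + 2) ((of_int (k * int p - 1) :: rat) gchoose (p - 1))
         (\<Sum>j=0..n. of_int (b j) * of_nat p ^ j * H j (p - 1))"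
        by (intro rat_cong_truncated_sum[OF _ _ r] padic_dvd_tail_exceptional) blast+
    qed
  qed simp
qed

end
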